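(* For all nonnegative integers $n,k$ with $0\le k\le n$, \[ \sum_{\pi \in \mathfrak{S}_{n}^{k}}\beta^{{\rm rlmin}(\pi)}q^{{\rm maj}(\pi)} = \sum_{\pi \in \mathfrak{S}_{n}^{k}}\beta^{{\rm rlmin}(\pi)}q^{{\rm inv}(\pi)}={n\brack k}_q [k+1]_{\beta,q}[k+2]_{\beta,q}\cdots [n]_{\beta,q}, \] where $\beta,q$ are indeterminates.
   Context: A partial permutation (Laguerre word) in $\mathfrak{S}_n^k$ is a word $\pi=\pi_1\pi_2\cdots\pi_n$ of length $n$ in which exactly $k$ letters are a hole symbol $\lozenge$ and the other $n-k$ letters are distinct elements of $[n]=\{1,\dots,n\}$. Letters are ordered $1<2<\cdots<n<\lozenge$. Let $S_\pi\subseteq[n]$ be the set of numerical letters of $\pi$ and $\overline S_\pi=[n]\setminus S_\pi$. For disjoint sets $A,B$ of integers, ${\rm inv}(A,B)=|\{(a,b)\in A\times B: a>b\}|$. For $i\in[n]$, ${\rm inv}^{\Box,i}(\pi)=|\{j: 1\le j<i,\ \pi_j>\pi_i\}|$, and ${\rm inv}_0(\pi)=\sum_{i=1}^n {\rm inv}^{\Box,i}(\pi)$. The descent set is ${\rm Des}(\pi)=\{i\in[n-1]:\pi_i>\pi_{i+1}\}$ and ${\rm maj}_0(\pi)=\sum_{i\in{\rm Des}(\pi)} i$. Define ${\rm inv}(\pi)={\rm inv}_0(\pi)+{\rm inv}(S_\pi,\overline S_\pi)$ and ${\rm maj}(\pi)={\rm maj}_0(\pi)+{\rm inv}(S_\pi,\overline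 S_\pi)$. A numerical letter $\pi_i\in[n]$ is a right-to-left minimum if every element of $\{1,\dots,\pi_i-1\}$ occurs in $\pi$ at a position before $i$; ${\rm rlmin}(\pi)$ is the number of right-to-left minima. For $m\ge1$, $[m]_{\beta,q}=\beta-1+1+q+\cdots+q^{m-1}=\beta+q+q^2+\cdots+q^{m-1}$; $[m]_q=1+q+\cdots+q^{m-1}$, $[m]_q!=[1]_q\cdots[m]_q$, $[0]_q!=1$, and ${n\brack k}_q=\frac{[n]_q!}{[k]_q![n-k]_q!}$. The empty product (when $k=n$) is $1$. *)

theory Defs
  imports
    "HOL-Library.Extended_Nat"
    "HOL-Computational_Algebra.Polynomial"
    "HOL-Computational_Algebra.Fraction_Field"
begin

text \<open>
  Letters are extended naturals: the numerical letter \<open>a\<close> is \<open>enat a\<close> and the hole symbol is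
  \<open>\<infinity>\<close>, so that the library order on \<^typ>\<open>enat\<close> is the letter order
  \<open>1 < 2 < \<dots> < n < hole\<close>. Positions in a word are numbered from \<open>1\<close>.
\<close>

abbreviation hole :: enat where
  "hole \<equiv> \<infinity>"

definition letter :: "enat list \<Rightarrow> nat \<Rightarrow> enat" where
  "letter w i = w ! (i - 1)"

definition partial_perms :: "nat \<Rightarrow> nat \<Rightarrow> enat list set" where
  "partial_perms n k =
     {w. length w = n \<and> set w \<subseteq> enat ` {1..n} \<union> {hole} \<and>
         count_list w hole = k \<and> distinct (filter (\<lambda>x. x \<noteq> hole) w)}"

lemma finite_partial_perms: "finite (partial_perms n k)"
proof (rule finite_subset)
  show "partial_perms n k \<subseteq> {w. set w \<subseteq> enat ` {1..n} \<union> {hole} \<and> length w = n}"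
    by (auto simp: partial_perms_def)
  show "finite {w. set w \<subseteq> enat ` {1..n} \<union> {hole} \<and> length w = n}"
    by (rule finite_lists_length_eq) simp
qed

definition num_letters :: "enat list \<Rightarrow> nat set" where
  "num_letters w = {a. enat a \<in> set w}"

definition missing_letters :: "enat list \<Rightarrow> nat set" where
  "missing_letters w = {1..length w} - num_letters w"

definition inv_sets :: "nat set \<Rightarrow> nat set \<Rightarrow> nat" where
  "inv_sets A B = card {(a, b) \<in> A \<times> B. a > b}"

definition inv_box :: "enat list \<Rightarrow> nat \<Rightarrow> nat" where
  "inv_box w i = card {j. 1 \<le> j \<and> j < i \<and> letter w j > letter w i}"

definition inv0 :: "enat list \<Rightarrow> nat" where
  "inv0 w = (\<Sum>i = 1..length w. inv_box w i)"

definition Des :: "enat list \<Rightarrow> nat set" where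
  "Des w = {i \<in> {1..length w - 1}. letter w i > letter w (i + 1)}"

definition maj0 :: "enat list \<Rightarrow> nat" where
  "maj0 w = \<Sum>(Des w)"

definition inv_stat :: "enat list \<Rightarrow> nat" where
  "inv_stat w = inv0 w + inv_sets (num_letters w) (missing_letters w)"

definition maj_stat :: "enat list \<Rightarrow> nat" where
  "maj_stat w = maj0 w + inv_sets (num_letters w) (missing_letters w)"

definition is_rlmin :: "enat list \<Rightarrow> nat \<Rightarrow> bool" where
  "is_rlmin w i \<longleftrightarrow>
     letter w i \<noteq> hole \<and>
     (\<forall>b::nat. 1 \<le> b \<and> enat b < letter w i \<longrightarrow> (\<exists>j. 1 \<le> j \<and> j < i \<and> letter w j = enat b))"

definition rlmin :: "enat list \<Rightarrow> nat" where
  "rlmin w = card {i \<in> {1..length w}. is_rlmin w i}"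

definition q_int :: "'a::field \<Rightarrow> nat \<Rightarrow> 'a" where
  "q_int q m = (\<Sum>i<m. q ^ i)"

definition q_fact :: "'a::field \<Rightarrow> nat \<Rightarrow> 'a" where
  "q_fact q m = (\<Prod>i = 1..m. q_int q i)"

text \<open>The following is meaningful for \<open>k \<le> n\<close> only (truncated subtraction).\<close>

definition q_binomial :: "'a::field \<Rightarrow> nat \<Rightarrow> nat \<Rightarrow> 'a" where
  "q_binomial q n k = q_fact q n / (q_fact q k * q_fact q (n - k))"

definition beta_q_int :: "'a::field \<Rightarrow> 'a \<Rightarrow> nat \<Rightarrow> 'a" where
  "beta_q_int \<beta> q m = \<beta> - 1 + q_int q m"

text \<open>
  The indeterminates \<open>\<beta>\<close> and \<open>q\<close> are the two generators of the polynomial ring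
  \<open>\<int>[q][\<beta>]\<close>, viewed inside its field of fractions so that the quotient defining the
  \<open>q\<close>-binomial coefficient is a genuine one. This ring embeds in the field, so an equation
  between polynomial expressions here is the polynomial identity.
\<close>

definition beta_var :: "int poly poly fract" where
  "beta_var = Fract [:0, 1:] 1"

definition q_var :: "int poly poly fract" where
  "q_var = Fract [:[:0, 1:]:] 1"

end

theory Submission
  imports Defs
begin

text \<open>
  Let \<open>st\<close> be \<open>inv0\<close> or \<open>maj0\<close>. Inserting \<open>k\<close> copies of a letter larger than all others into a word
  \<open>v\<close> of length \<open>m\<close> in all possible ways multiplies \<open>q ^ st v\<close> by the \<open>q\<close>-binomial coefficient
  \<open>m + k\<close> over \<open>k\<close>. Holes affect neither \<open>rlmin\<close> nor the set of missing letters, so removing them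
  accounts for the factor \<open>q_binomial q n k\<close> and leaves the sum \<open>F n l\<close> over the words of \<open>l = n - k\<close>
  distinct letters from \<open>{1..n}\<close>.

  Such a word over \<open>{1..n + 1}\<close> of length \<open>l + 1\<close> either omits \<open>n + 1\<close>, or arises by inserting it into a
  word of length \<open>l\<close> over \<open>{1..n}\<close>. The inserted letter gains \<open>q ^ (n - l)\<close> from the missing letters
  and is a right-to-left minimum iff \<open>l = n\<close> and it is placed last. Hence, for \<open>l < n\<close>,
  \<open>F (n + 1) (l + 1) = F n (l + 1) + q ^ (n - l) * q_int q (l + 1) * F n l\<close>, which the product of the
  \<open>beta_q_int \<beta> q m\<close> over \<open>m = n - l + 1..n\<close> satisfies as well.
\<close>

section \<open>Inserting copies of a letter\<close>

text \<open>Encoded as a fibre of the deletion of \<open>c\<close>: equal copies of \<open>c\<close>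
  are not told apart, and the sets for distinct \<open>v\<close> are disjoint at once.\<close>

definition insertions :: "'a \<Rightarrow> 'a list \<Rightarrow> nat \<Rightarrow> 'a list set" where
  "insertions c v k = {w. filter (\<lambda>x. x \<noteq> c) w = v \<and> count_list w c = k}"

lemma length_filter_count: "length w = length (filter (\<lambda>x. x \<noteq> c) w) + count_list w c"
  by (induction w) auto

lemma count_list_distinct: "distinct w \<Longrightarrow> c \<in> set w \<Longrightarrow> count_list w c = Suc 0"
  by (induction w) (auto simp: count_list_0_iff)

lemma length_insertions: "w \<in> insertions c v k \<Longrightarrow> length w = length v + k"
  using length_filter_count[of w c] by (simp add: insertions_def)

lemma set_insertions: "w \<in> insertions c v k \<Longrightarrow> set w \<subseteq> insert c (set v)"
  by (auto simp: insertions_def)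

lemma insertions_0: "c \<notin> set v \<Longrightarrow> insertions c v 0 = {v}"
proof -
  assume c: "c \<notin> set v"
  have "filter (\<lambda>x. x \<noteq> c) w = w" if "count_list w c = 0" for w
    using that by (auto simp: count_list_0_iff intro!: filter_True)
  moreover have "filter (\<lambda>x. x \<noteq> c) v = v" "count_list v c = 0"
    using c by (auto simp: count_list_0_iff intro!: filter_True)
  ultimately show ?thesis by (auto simp: insertions_def)
qed

lemma insertions_disjoint: "u \<noteq> v \<Longrightarrow> insertions c u k \<inter> insertions c v k = {}"
  by (auto simp: insertions_def)

lemma insertions_Nil: "insertions c [] k = {replicate k c}"
proof -
  have "w = replicate k c" if "w \<in> insertions c [] k" for w
    using that length_insertions[OF that] set_insertions[OF that]
    by (auto intro!: replicate_eqI)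
  moreover have "replicate k c \<in> insertions c [] k"
    by (induction k) (auto simp: insertions_def)
  ultimately show ?thesis by blast
qed

text \<open>A word in the set ends either in \<open>c\<close> or in the last letter of
  \<open>v @ [a]\<close>. This is the combinatorial source of the \<open>q\<close>-Pascal
  recurrences.\<close>

lemma insertions_snoc_Suc:
  assumes "a \<noteq> c"
  shows "insertions c (v @ [a]) (Suc k) =
    (\<lambda>w. w @ [c]) ` insertions c (v @ [a]) k \<union> (\<lambda>w. w @ [a]) ` insertions c v (Suc k)"
    (is "?L = ?R")
proof
  show "?L \<subseteq> ?R"
  proof
    fix w assume w: "w \<in> ?L"
    then obtain u x where ux: "w = u @ [x]"
      by (cases w rule: rev_cases) (auto simp: insertions_def)
    show "w \<in> ?R"
      using w ux by (cases "x = c") (auto simp: insertions_def)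
  qed
  show "?R \<subseteq> ?L"
    using assms by (auto simp: insertions_def)
qed

lemma finite_insertions: "finite (insertions c v k)"
proof (rule finite_subset)
  show "insertions c v k \<subseteq> {w. set w \<subseteq> insert c (set v) \<and> length w = length v + k}"
    using length_insertions set_insertions by fast
  show "finite {w. set w \<subseteq> insert c (set v) \<and> length w = length v + k}"
    by (rule finite_lists_length_eq) simp
qed

lemma sum_insertions_snoc_Suc:
  fixes f :: "'a list \<Rightarrow> 'b::comm_monoid_add"
  assumes "a \<noteq> c"
  shows "(\<Sum>w\<in>insertions c (v @ [a]) (Suc k). f w) =
    (\<Sum>w\<in>insertions c (v @ [a]) k. f (w @ [c])) + (\<Sum>w\<in>insertions c v (Suc k). f (w @ [a]))"
proof -
  have "(\<Sum>w\<in>insertions c (v @ [a]) (Suc k). f w) =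
      (\<Sum>w\<in>(\<lambda>w. w @ [c]) ` insertions c (v @ [a]) k. f w) +
      (\<Sum>w\<in>(\<lambda>w. w @ [a]) ` insertions c v (Suc k). f w)"
    unfolding insertions_snoc_Suc[OF assms]
    by (rule sum.union_disjoint) (use assms in \<open>auto simp: finite_insertions\<close>)
  then show ?thesis
    by (simp add: sum.reindex inj_on_def)
qed

section \<open>The statistics under appending a letter\<close>

lemma letter_snoc: "1 \<le> i \<Longrightarrow> i \<le> length w \<Longrightarrow> letter (w @ [a]) i = letter w i"
  by (auto simp: letter_def nth_append)

lemma letter_snoc_last: "letter (w @ [a]) (Suc (length w)) = a"
  by (simp add: letter_def)

lemma inv0_Nil: "inv0 [] = 0"
  by (simp add: inv0_def)

lemma inv0_snoc: "inv0 (w @ [a]) = inv0 w + length (filter (\<lambda>x. a < x) w)"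
proof -
  have old: "inv_box (w @ [a]) i = inv_box w i" if "i \<in> {1..length w}" for i
    using that unfolding inv_box_def
    by (intro arg_cong[where f = card]) (auto simp: letter_snoc)
  \<comment> \<open>\<open>Suc\<close> turns the list indices, which start at 0, into positions,
    which start at 1.\<close>
  have "inv_box (w @ [a]) (Suc (length w)) = card (Suc ` {i. i < length w \<and> a < w ! i})"
    unfolding inv_box_def
    by (intro arg_cong[where f = card])
      (auto simp: letter_def nth_append image_iff Suc_le_eq gr0_conv_Suc split: if_splits)
  also have "\<dots> = length (filter (\<lambda>x. a < x) w)"
    by (simp add: card_image length_filter_conv_card)
  finally show ?thesis
    using old by (simp add: inv0_def)
qed

lemma maj0_Nil: "maj0 [] = 0"
  by (simp add: maj0_def Des_def)

lemma maj0_snoc: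
  "maj0 (w @ [a]) = maj0 w + (if w \<noteq> [] \<and> a < last w then length w else 0)"
proof -
  have old: "i \<in> Des (w @ [a]) \<longleftrightarrow> i \<in> Des w" if "i < length w" for i
    using that by (auto simp: Des_def letter_def nth_append)
  have new: "length w \<in> Des (w @ [a]) \<longleftrightarrow> w \<noteq> [] \<and> a < last w"
    by (cases w rule: rev_cases) (auto simp: Des_def letter_def nth_append)
  have "i \<in> Des (w @ [a]) \<longleftrightarrow>
      i \<in> Des w \<union> (if w \<noteq> [] \<and> a < last w then {length w} else {})" for i
  proof (rule linorder_cases[of i "length w"])
    assume "length w < i"
    then show ?thesis by (auto simp: Des_def)
  next
    assume "i = length w"
    moreover have "length w \<notin> Des w" by (cases w) (auto simp: Des_def)
    ultimately show ?thesis using new by simp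
  qed (simp add: old)
  then have "Des (w @ [a]) = Des w \<union> (if w \<noteq> [] \<and> a < last w then {length w} else {})"
    by blast
  moreover have "length w \<notin> Des w" if "w \<noteq> []"
    using that by (cases w) (auto simp: Des_def)
  moreover have "finite (Des w)" by (simp add: Des_def)
  ultimately show ?thesis by (simp add: maj0_def)
qed

lemma rlmin_Nil: "rlmin [] = 0"
  by (simp add: rlmin_def)

text \<open>Being a right-to-left minimum depends only on the prefix ending at the position, so old
  positions keep their status.\<close>

lemma rlmin_snoc:
  "rlmin (w @ [a]) =
    rlmin w + (if a \<noteq> hole \<and> (\<forall>b\<ge>1. enat b < a \<longrightarrow> enat b \<in> set w) then 1 else 0)"
proof -
  have old: "is_rlmin (w @ [a]) i \<longleftrightarrow> is_rlmin w i" if "i \<in> {1..length w}" for i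
  proof -
    have "(1 \<le> j \<and> j < i \<and> letter (w @ [a]) j = x) \<longleftrightarrow> (1 \<le> j \<and> j < i \<and> letter w j = x)" for j x
      using that by (auto simp: letter_snoc)
    then show ?thesis
      using that by (simp add: is_rlmin_def letter_snoc)
  qed
  have mem: "(\<exists>j. 1 \<le> j \<and> j < Suc (length w) \<and> letter (w @ [a]) j = x) \<longleftrightarrow> x \<in> set w" for x
  proof
    assume "x \<in> set w"
    then obtain i where "i < length w" "w ! i = x" by (auto simp: in_set_conv_nth)
    then have "1 \<le> Suc i \<and> Suc i < Suc (length w) \<and> letter (w @ [a]) (Suc i) = x"
      by (simp add: letter_def nth_append)
    then show "\<exists>j. 1 \<le> j \<and> j < Suc (length w) \<and> letter (w @ [a]) j = x" by blast
  qed (auto simp: letter_def nth_append)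
  have new: "is_rlmin (w @ [a]) (Suc (length w)) \<longleftrightarrow>
      a \<noteq> hole \<and> (\<forall>b\<ge>1. enat b < a \<longrightarrow> enat b \<in> set w)"
    unfolding is_rlmin_def mem letter_snoc_last by auto
  have "{i \<in> {1..length (w @ [a])}. is_rlmin (w @ [a]) i} =
      {i \<in> {1..length w}. is_rlmin w i} \<union>
      (if is_rlmin (w @ [a]) (Suc (length w)) then {Suc (length w)} else {})"
    using old by (auto simp: le_Suc_eq)
  then show ?thesis
    by (simp add: rlmin_def new)
qed

text \<open>A hole is never counted, and the condition on a numerical letter asks only for numerical
  letters.\<close>

lemma rlmin_filter_hole: "rlmin (filter (\<lambda>x. x \<noteq> hole) w) = rlmin w"
proof (induction w rule: rev_induct)
  case (snoc a w)
  have "(enat b \<in> set (filter (\<lambda>x. x \<noteq> hole) w)) = (enat b \<in> set w)" for b by auto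
  with snoc show ?case by (auto simp: rlmin_snoc)
qed simp

text \<open>The letters of \<open>y\<close> are smaller than \<open>c\<close>, so their conditions
  never ask for \<open>c\<close>; those of \<open>x\<close> stand before it.\<close>

lemma rlmin_insert:
  assumes "\<forall>x\<in>set y. x < c"
  shows "rlmin (x @ c # y) = rlmin (x @ y) +
    (if c \<noteq> hole \<and> (\<forall>b\<ge>1. enat b < c \<longrightarrow> enat b \<in> set x) then 1 else 0)"
  using assms
proof (induction y rule: rev_induct)
  case Nil
  then show ?case by (simp add: rlmin_snoc)
next
  case (snoc a y)
  have "(\<forall>b\<ge>1. enat b < a \<longrightarrow> enat b \<in> set (x @ c # y)) \<longleftrightarrow>
      (\<forall>b\<ge>1. enat b < a \<longrightarrow> enat b \<in> set (x @ y))"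
    using snoc.prems by auto
  then show ?case
    using snoc rlmin_snoc[of "x @ c # y" a] rlmin_snoc[of "x @ y" a] by simp
qed

lemma inv0_snoc_greatest: "\<forall>x\<in>set w. x \<le> c \<Longrightarrow> inv0 (w @ [c]) = inv0 w"
  by (simp add: inv0_snoc filter_empty_conv not_less)

lemma maj0_snoc_greatest: "\<forall>x\<in>set w. x \<le> c \<Longrightarrow> maj0 (w @ [c]) = maj0 w"
  by (auto simp: maj0_snoc not_less dest: last_in_set)

lemma maj0_replicate: "maj0 (replicate k c) = 0"
proof (induction k)
  case (Suc k)
  then show ?case
    using maj0_snoc_greatest[of "replicate k c" c] by (simp add: replicate_append_same)
qed (simp add: maj0_Nil)

lemma inv0_replicate: "inv0 (replicate k c) = 0"
proof (induction k)
  case (Suc k)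
  then show ?case
    using inv0_snoc_greatest[of "replicate k c" c] by (simp add: replicate_append_same)
qed (simp add: inv0_Nil)

lemma length_filter_greater_insertions:
  assumes "w \<in> insertions c u k" "a < c"
  shows "length (filter (\<lambda>x. a < x) w) = k + length (filter (\<lambda>x. a < x) u)"
proof -
  have "length (filter (\<lambda>x. a < x) w) =
      count_list w c + length (filter (\<lambda>x. a < x) (filter (\<lambda>x. x \<noteq> c) w))"
    using assms(2) by (induction w) auto
  with assms(1) show ?thesis by (simp add: insertions_def)
qed

section \<open>Insertion of a greatest letter\<close>

lemma q_int_1: "q_int q (Suc 0) = 1"
  by (simp add: q_int_def)

lemma q_int_add: "q_int q (m + k) = q_int q k + q ^ k * q_int q m"
proof (induction m)
  case (Suc m)
  then show ?case
    by (simp add: q_int_def algebra_simps power_add)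
qed (simp add: q_int_def)

lemma q_fact_0: "q_fact q 0 = 1"
  by (simp add: q_fact_def)

lemma q_fact_Suc: "q_fact q (Suc m) = q_int q (Suc m) * q_fact q m"
  by (simp add: q_fact_def)

text \<open>The quotient \<open>q_binomial\<close> degenerates where a \<open>q\<close>-integer
  vanishes, as at a nontrivial root of unity; the assumption licenses the cancellations
  below.\<close>

locale nonzero_q_ints =
  fixes q :: "'a::field"
  assumes q_int_nonzero: "q_int q (Suc m) \<noteq> 0"
begin

lemma q_fact_nonzero: "q_fact q m \<noteq> 0"
  by (induction m) (simp_all add: q_fact_0 q_fact_Suc q_int_nonzero)

lemma q_binomial_0_right: "q_binomial q n 0 = 1"
  by (simp add: q_binomial_def q_fact_0 q_fact_nonzero)

lemma q_binomial_same: "q_binomial q n n = 1"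
  by (simp add: q_binomial_def q_fact_0 q_fact_nonzero)

lemma q_binomial_1_right: "q_binomial q (Suc m) (Suc 0) = q_int q (Suc m)"
  by (simp add: q_binomial_def q_fact_0 q_fact_Suc q_int_1 q_fact_nonzero)

lemma q_binomial_symmetric: "q_binomial q (m + k) k = q_binomial q (k + m) m"
  by (simp add: q_binomial_def add.commute mult.commute)

text \<open>Over a common denominator this is the splitting of
  \<open>q_int q (Suc m + Suc k)\<close> by \<open>q_int_add\<close>.\<close>

lemma q_binomial_pascal:
  "q_binomial q (Suc m + Suc k) (Suc k) =
    q_binomial q (Suc m + k) k + q ^ Suc k * q_binomial q (m + Suc k) (Suc k)"
proof -
  have "q_int q (Suc m + Suc k) = q_int q (Suc k) + q ^ Suc k * q_int q (Suc m)"
    by (rule q_int_add)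
  then show ?thesis
    by (simp add: q_binomial_def q_fact_Suc q_fact_nonzero q_int_nonzero field_simps)
qed

text \<open>The mirror image under \<open>q_binomial_symmetric\<close>, with the power of
  \<open>q\<close> on the other term.\<close>

lemma q_binomial_pascal':
  "q_binomial q (Suc m + Suc k) (Suc k) =
    q ^ Suc m * q_binomial q (Suc m + k) k + q_binomial q (m + Suc k) (Suc k)"
  using q_binomial_pascal[of k m]
  unfolding q_binomial_symmetric[of "Suc k" m] q_binomial_symmetric[of k "Suc m"]
    q_binomial_symmetric[of "Suc k" "Suc m"]
  by (simp only: add.commute)

text \<open>Taking \<open>c = hole\<close> fills in the holes of a partial permutation; taking \<open>c = enat (Suc n)\<close> and
  \<open>k = 1\<close> gives the recursion on the size of the alphabet.\<close>

definition mahonian :: "(enat list \<Rightarrow> nat) \<Rightarrow> bool" where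
  "mahonian st \<longleftrightarrow> st [] = 0 \<and> (\<forall>c v. (\<forall>x\<in>set v. x < c) \<longrightarrow> st (v @ [c]) = st v \<and>
    (\<forall>k. (\<Sum>w\<in>insertions c v k. q ^ st w) = q ^ st v * q_binomial q (length v + k) k))"

text \<open>A final \<open>c\<close> creates no inversion, whereas a final letter \<open>a\<close>
  of \<open>v\<close> is preceded by all \<open>Suc k\<close> copies of \<open>c\<close>; this
  supplies the factor \<open>q ^ Suc k\<close> in Pascal's recurrence.\<close>

lemma sum_inv0_insertions:
  assumes "\<forall>x\<in>set v. x < c"
  shows "(\<Sum>w\<in>insertions c v k. q ^ inv0 w) = q ^ inv0 v * q_binomial q (length v + k) k"
  using assms
proof (induction v arbitrary: k rule: rev_induct)
  case Nil
  then show ?case by (simp add: insertions_Nil inv0_replicate inv0_Nil q_binomial_same)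
next
  case (snoc a u)
  then have a: "a < c" "a \<noteq> c" and u: "\<forall>x\<in>set u. x < c" by auto
  let ?e = "length (filter (\<lambda>x. a < x) u)"
  show ?case
  proof (induction k)
    case 0
    have "c \<notin> set (u @ [a])" using snoc.prems by auto
    then show ?case by (simp add: insertions_0 q_binomial_0_right)
  next
    case (Suc k)
    have 1: "inv0 (w @ [c]) = inv0 w" if "w \<in> insertions c (u @ [a]) k" for w
      using set_insertions[OF that] snoc.prems by (intro inv0_snoc_greatest) (auto simp: le_less)
    have 2: "inv0 (w @ [a]) = inv0 w + (Suc k + ?e)" if "w \<in> insertions c u (Suc k)" for w
      using length_filter_greater_insertions[OF that a(1)] by (simp add: inv0_snoc)
    have "(\<Sum>w\<in>insertions c (u @ [a]) (Suc k). q ^ inv0 w) =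
        (\<Sum>w\<in>insertions c (u @ [a]) k. q ^ inv0 w) +
        (\<Sum>w\<in>insertions c u (Suc k). q ^ inv0 w) * q ^ (Suc k + ?e)"
      unfolding sum_insertions_snoc_Suc[OF a(2)] sum_distrib_right
      by (intro arg_cong2[where f = "(+)"] sum.cong refl) (simp_all only: 1 2 power_add)
    also have "\<dots> = q ^ inv0 (u @ [a]) * q_binomial q (Suc (length u) + Suc k) (Suc k)"
      unfolding q_binomial_pascal Suc.IH snoc.IH[OF u]
      by (simp add: inv0_snoc power_add algebra_simps)
    finally show ?case by simp
  qed
qed

text \<open>The last letter of \<open>w\<close> decides whether appending \<open>a\<close> creates a descent, so the induction has to
  carry along the sums over the words \<open>w @ [a]\<close>.\<close>

lemma sum_maj0_insertions:
  assumes "\<forall>x\<in>set u. x < c"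
  shows "(\<forall>k. (\<Sum>w\<in>insertions c u k. q ^ maj0 w) = q ^ maj0 u * q_binomial q (length u + k) k) \<and>
    (\<forall>a<c. \<forall>k. (\<Sum>w\<in>insertions c u k. q ^ maj0 (w @ [a])) =
      q ^ maj0 (u @ [a]) * q ^ k * q_binomial q (length u + k) k)"
  using assms
proof (induction u rule: rev_induct)
  case Nil
  have single: "maj0 [a] = 0" for a
    using maj0_snoc[of "[]" a] by (simp add: maj0_Nil)
  \<comment> \<open>For \<open>k > 0\<close> the only descent is at position \<open>k\<close>; for
    \<open>k = 0\<close> there is none.\<close>
  then have "maj0 (replicate k c @ [a]) = k" if "a < c" for a k
    using that by (cases "k = 0") (simp_all add: maj0_snoc maj0_replicate)
  with single show ?case
    by (simp add: insertions_Nil maj0_replicate maj0_Nil q_binomial_same)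
next
  case (snoc b u)
  then have b: "b < c" "b \<noteq> c" and u: "\<forall>x\<in>set u. x < c" and c: "c \<notin> set (u @ [b])" by auto
  have IH: "(\<Sum>w\<in>insertions c u k. q ^ maj0 (w @ [b])) =
      q ^ maj0 (u @ [b]) * q ^ k * q_binomial q (length u + k) k" for k
    using snoc.IH[OF u] b by blast
  \<comment> \<open>Pascal's recurrence again: for the words ending in \<open>b\<close>, the
    induction hypothesis on appended letters supplies the factor \<open>q ^ Suc k\<close>.\<close>
  have G: "(\<Sum>w\<in>insertions c (u @ [b]) k. q ^ maj0 w) =
      q ^ maj0 (u @ [b]) * q_binomial q (Suc (length u) + k) k" for k
  proof (induction k)
    case 0
    show ?case using c by (simp add: insertions_0 q_binomial_0_right)
  next
    case (Suc k)
    have "maj0 (w @ [c]) = maj0 w" if "w \<in> insertions c (u @ [b]) k" for w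
      using set_insertions[OF that] snoc.prems by (intro maj0_snoc_greatest) (auto simp: le_less)
    then have "(\<Sum>w\<in>insertions c (u @ [b]) (Suc k). q ^ maj0 w) =
        (\<Sum>w\<in>insertions c (u @ [b]) k. q ^ maj0 w) +
        (\<Sum>w\<in>insertions c u (Suc k). q ^ maj0 (w @ [b]))"
      by (simp add: sum_insertions_snoc_Suc[OF b(2)])
    then show ?case
      unfolding q_binomial_pascal Suc.IH IH by (simp add: algebra_simps)
  qed
  have E: "(\<Sum>w\<in>insertions c (u @ [b]) k. q ^ maj0 (w @ [a])) =
      q ^ maj0 (u @ [b, a]) * q ^ k * q_binomial q (Suc (length u) + k) k" if "a < c" for a k
  proof (cases k)
    case 0
    then show ?thesis using c by (simp add: insertions_0 q_binomial_0_right)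
  next
    case (Suc k')
    have uba: "maj0 (u @ [b, a]) = maj0 (u @ [b]) + (if a < b then Suc (length u) else 0)"
      using maj0_snoc[of "u @ [b]" a] by simp
    \<comment> \<open>The descent from \<open>c\<close> to \<open>a\<close> is at position
      \<open>length w + 1\<close>, which is \<open>Suc (length u) + k\<close> because
      \<open>k = Suc k'\<close>.\<close>
    have 1: "maj0 (w @ [c] @ [a]) = maj0 w + (Suc (length u) + k)"
      if "w \<in> insertions c (u @ [b]) k'" for w
    proof -
      have "maj0 (w @ [c]) = maj0 w"
        using set_insertions[OF that] snoc.prems by (intro maj0_snoc_greatest) (auto simp: le_less)
      then show ?thesis
        using maj0_snoc[of "w @ [c]" a] length_insertions[OF that] \<open>a < c\<close> Suc by simp
    qed
    have 2: "maj0 (w @ [b] @ [a]) = maj0 (w @ [b]) + (if a < b then Suc (length u) + k else 0)"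
      if "w \<in> insertions c u (Suc k')" for w
      using maj0_snoc[of "w @ [b]" a] length_insertions[OF that] Suc by simp
    have "(\<Sum>w\<in>insertions c (u @ [b]) k. q ^ maj0 (w @ [a])) =
        (\<Sum>w\<in>insertions c (u @ [b]) k'. q ^ maj0 w) * q ^ (Suc (length u) + k) +
        (\<Sum>w\<in>insertions c u (Suc k'). q ^ maj0 (w @ [b])) * q ^ (if a < b then Suc (length u) + k else 0)"
      unfolding Suc sum_insertions_snoc_Suc[OF b(2)] sum_distrib_right append_assoc
      by (intro arg_cong2[where f = "(+)"] sum.cong refl)
        (simp_all only: 1[unfolded Suc] 2[unfolded Suc] power_add)
    also have "\<dots> = q ^ maj0 (u @ [b, a]) * q ^ k * q_binomial q (Suc (length u) + k) k"
    \<comment> \<open>If \<open>a < b\<close>, both sums gain the same power of \<open>q\<close> and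
      the first Pascal recurrence applies. Otherwise only the words ending in \<open>c\<close> gain
      it, which is the mirrored recurrence.\<close>
    proof (cases "a < b")
      case True
      then show ?thesis
        unfolding G IH Suc q_binomial_pascal uba by (simp add: power_add algebra_simps)
    next
      case False
      then show ?thesis
        unfolding G IH Suc q_binomial_pascal' uba by (simp add: power_add algebra_simps)
    qed
    finally show ?thesis .
  qed
  show ?case using G E by simp
qed

lemma mahonian_inv0: "mahonian inv0"
  unfolding mahonian_def
  by (auto simp: inv0_Nil sum_inv0_insertions le_less intro!: inv0_snoc_greatest)

lemma mahonian_maj0: "mahonian maj0"
  unfolding mahonian_def
  using sum_maj0_insertions by (auto simp: maj0_Nil le_less intro!: maj0_snoc_greatest)

text \<open>Only \<open>v @ [c]\<close> ends in \<open>c\<close>, and its weight is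
  \<open>q ^ st v\<close>; marking it by \<open>\<beta>\<close> therefore replaces the term 1 of the
  \<open>q\<close>-integer by \<open>\<beta>\<close>.\<close>

lemma sum_insert_greatest:
  assumes st: "mahonian st" and v: "\<forall>x\<in>set v. x < c"
  shows "(\<Sum>w\<in>insertions c v (Suc 0). (if last w = c then \<beta> else 1) * q ^ st w) =
    q ^ st v * beta_q_int \<beta> q (Suc (length v))"
proof -
  have mem: "v @ [c] \<in> insertions c v (Suc 0)"
  proof -
    have "v \<in> insertions c v 0" using v by (subst insertions_0) auto
    then show ?thesis by (simp add: insertions_def)
  qed
  have last: "last w = c \<longleftrightarrow> w = v @ [c]" if "w \<in> insertions c v (Suc 0)" for w
  proof
    assume "last w = c"
    moreover have "w \<noteq> []" using that by (auto simp: insertions_def)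
    ultimately obtain u where u: "w = u @ [c]"
      by (metis append_butlast_last_id)
    with that have "u \<in> insertions c v 0" by (simp add: insertions_def)
    then have "u = v" using v by (subst (asm) insertions_0) auto
    with u show "w = v @ [c]" by simp
  qed simp
  have "(\<Sum>w\<in>insertions c v (Suc 0). (if last w = c then \<beta> else 1) * q ^ st w) =
      (\<Sum>w\<in>insertions c v (Suc 0). q ^ st w + (if w = v @ [c] then (\<beta> - 1) * q ^ st w else 0))"
    by (intro sum.cong refl) (auto simp: last algebra_simps)
  also have "\<dots> = (\<Sum>w\<in>insertions c v (Suc 0). q ^ st w) + (\<beta> - 1) * q ^ st (v @ [c])"
    using mem by (simp add: sum.distrib finite_insertions)
  also have "\<dots> = q ^ st v * beta_q_int \<beta> q (Suc (length v))"
    using st v by (simp add: mahonian_def beta_q_int_def q_binomial_1_right algebra_simps)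
  finally show ?thesis .
qed

end

section \<open>Words without holes\<close>

lemma insertions_1_split:
  assumes "w \<in> insertions c v (Suc 0)"
  obtains x y where "w = x @ c # y" "v = x @ y" "c \<notin> set x" "c \<notin> set y"
proof -
  have "c \<in> set w"
    using assms count_list_0_iff[of w c] by (auto simp: insertions_def)
  then obtain x y where w: "w = x @ c # y" "c \<notin> set x"
    by (meson split_list_first)
  then have "count_list y c = 0"
    using assms by (simp add: insertions_def)
  then have y: "c \<notin> set y"
    by (simp add: count_list_0_iff)
  have "filter (\<lambda>x. x \<noteq> c) x = x" "filter (\<lambda>x. x \<noteq> c) y = y"
    using w(2) y by (auto intro!: filter_True)
  then have "v = x @ y"
    using assms w(1) by (simp add: insertions_def)
  with w y that show thesis by blast
qed

definition arrangements :: "nat \<Rightarrow> nat \<Rightarrow> enat list set" where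
  "arrangements n l = {v. distinct v \<and> set v \<subseteq> enat ` {1..n} \<and> length v = l}"

lemma finite_arrangements: "finite (arrangements n l)"
proof (rule finite_subset)
  show "arrangements n l \<subseteq> {v. set v \<subseteq> enat ` {1..n} \<and> length v = l}"
    by (auto simp: arrangements_def)
  show "finite {v. set v \<subseteq> enat ` {1..n} \<and> length v = l}"
    by (rule finite_lists_length_eq) simp
qed

lemma arrangements_less: "v \<in> arrangements n l \<Longrightarrow> \<forall>x\<in>set v. x < enat (Suc n)"
  by (auto simp: arrangements_def)

lemma arrangements_less_hole: "v \<in> arrangements n l \<Longrightarrow> \<forall>x\<in>set v. x < hole"
  by (auto simp: arrangements_def)

lemma arrangements_0: "arrangements n 0 = {[]}"
  by (auto simp: arrangements_def)

lemma num_letters_arrangement: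
  assumes "v \<in> arrangements n l"
  shows "num_letters v \<subseteq> {1..n}" "card (num_letters v) = l" "set v = enat ` num_letters v"
proof -
  show sub: "num_letters v \<subseteq> {1..n}" and eq: "set v = enat ` num_letters v"
    using assms by (auto simp: arrangements_def num_letters_def)
  have "card (set v) = l"
    using assms by (auto simp: arrangements_def distinct_card)
  then show "card (num_letters v) = l"
    unfolding eq by (simp add: card_image inj_on_def)
qed

lemma arrangements_too_long: "n < l \<Longrightarrow> arrangements n l = {}"
proof (rule ccontr)
  assume "n < l" "arrangements n l \<noteq> {}"
  then obtain v where "v \<in> arrangements n l" by blast
  from num_letters_arrangement[OF this] card_mono[of "{1..n}" "num_letters v"] \<open>n < l\<close>
  show False by simp
qed

lemma arrangements_Suc:
  "arrangements (Suc n) (Suc l) = arrangements n (Suc l) \<union>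
    (\<Union>v\<in>arrangements n l. insertions (enat (Suc n)) v (Suc 0))" (is "?L = ?R")
proof
  show "?L \<subseteq> ?R"
  proof
    fix w assume w: "w \<in> ?L"
    show "w \<in> ?R"
    proof (cases "enat (Suc n) \<in> set w")
      case True
      let ?v = "filter (\<lambda>x. x \<noteq> enat (Suc n)) w"
      have "count_list w (enat (Suc n)) = Suc 0"
        using True w count_list_distinct by (auto simp: arrangements_def)
      then have ins: "w \<in> insertions (enat (Suc n)) ?v (Suc 0)"
        by (simp add: insertions_def)
      moreover have "?v \<in> arrangements n l"
        using w length_insertions[OF ins] by (force simp: arrangements_def le_Suc_eq)
      ultimately show ?thesis by blast
    next
      case False
      then have "w \<in> arrangements n (Suc l)"
        using w by (force simp: arrangements_def le_Suc_eq)
      then show ?thesis ..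
    qed
  qed
  show "?R \<subseteq> ?L"
  proof
    fix w assume "w \<in> ?R"
    then consider "w \<in> arrangements n (Suc l)" |
      v where "v \<in> arrangements n l" "w \<in> insertions (enat (Suc n)) v (Suc 0)" by blast
    then show "w \<in> ?L"
    proof cases
      case 1
      then show ?thesis by (force simp: arrangements_def)
    next
      case (2 v)
      from 2(2) obtain x y where "w = x @ enat (Suc n) # y" "v = x @ y"
          "enat (Suc n) \<notin> set x" "enat (Suc n) \<notin> set y"
        by (rule insertions_1_split)
      with 2(1) show ?thesis by (force simp: arrangements_def)
    qed
  qed
qed

lemma rlmin_insert_greatest:
  assumes v: "v \<in> arrangements n l" and w: "w \<in> insertions (enat (Suc n)) v (Suc 0)"
  shows "rlmin w = rlmin v + (if l = n \<and> last w = enat (Suc n) then 1 else 0)"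
proof -
  from w obtain x y where xy: "w = x @ enat (Suc n) # y" "v = x @ y"
      "enat (Suc n) \<notin> set x" "enat (Suc n) \<notin> set y"
    by (rule insertions_1_split)
  have "(\<forall>b\<ge>1. enat b < enat (Suc n) \<longrightarrow> enat b \<in> set x) \<longleftrightarrow> l = n \<and> y = []"
  proof
    assume "\<forall>b\<ge>1. enat b < enat (Suc n) \<longrightarrow> enat b \<in> set x"
    then have all: "enat ` {1..n} \<subseteq> set x" by auto
    have "set x \<subseteq> enat ` {1..n}" "distinct v" "set y \<subseteq> enat ` {1..n}" "length v = l"
      using v xy by (auto simp: arrangements_def)
    \<comment> \<open>Since \<open>v\<close> is distinct, no letter is left for \<open>y\<close>
      once \<open>x\<close> exhausts the alphabet.\<close>
    with all xy(2) have "set x = enat ` {1..n}" "y = []"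
      by (cases y; auto)+
    then show "l = n \<and> y = []"
      using \<open>distinct v\<close> \<open>length v = l\<close> distinct_card[of x] xy(2)
      by (simp add: card_image inj_on_def)
  next
    assume l: "l = n \<and> y = []"
    then have "num_letters v = {1..n}"
      using num_letters_arrangement[OF v] card_subset_eq[of "{1..n}" "num_letters v"] by simp
    with l xy num_letters_arrangement(3)[OF v]
    show "\<forall>b\<ge>1. enat b < enat (Suc n) \<longrightarrow> enat b \<in> set x" by auto
  qed
  moreover have "last w = enat (Suc n) \<longleftrightarrow> y = []"
    using xy by (auto dest: last_in_set)
  moreover have "\<forall>a\<in>set y. a < enat (Suc n)"
    using arrangements_less[OF v] xy by simp
  ultimately show ?thesis
    unfolding xy using rlmin_insert[of y "enat (Suc n)" x] by simp
qed

text \<open>The alphabet size is explicit: \<open>missing_letters\<close> reads it off the length of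
  the word, which changes when holes are removed.\<close>

definition missing_inv :: "nat \<Rightarrow> enat list \<Rightarrow> nat" where
  "missing_inv n v = inv_sets (num_letters v) ({1..n} - num_letters v)"

text \<open>The additional missing letter \<open>Suc n\<close> exceeds every letter of
  \<open>v\<close>, so it is the smaller entry of no pair.\<close>

lemma missing_inv_Suc:
  assumes "v \<in> arrangements n l"
  shows "missing_inv (Suc n) v = missing_inv n v"
proof -
  have "{(a, b) \<in> num_letters v \<times> ({1..Suc n} - num_letters v). a > b} =
      {(a, b) \<in> num_letters v \<times> ({1..n} - num_letters v). a > b}"
    using num_letters_arrangement(1)[OF assms] by (auto simp: le_Suc_eq)
  then show ?thesis by (simp add: missing_inv_def inv_sets_def)
qed

text \<open>The new letter exceeds each of the \<open>n - l\<close> letters of \<open>{1..n}\<close>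
  missing from \<open>v\<close>.\<close>

lemma missing_inv_insert_greatest:
  assumes v: "v \<in> arrangements n l" and w: "w \<in> insertions (enat (Suc n)) v (Suc 0)"
  shows "missing_inv (Suc n) w = missing_inv n v + (n - l)"
proof -
  let ?N = "num_letters v" and ?M = "{1..n} - num_letters v"
  from w obtain x y where "w = x @ enat (Suc n) # y" "v = x @ y"
    by (rule insertions_1_split)
  then have N: "num_letters w = insert (Suc n) ?N" by (auto simp: num_letters_def)
  moreover have "{1..Suc n} - num_letters w = ?M"
    unfolding N by (simp add: atLeastAtMostSuc_conv)
  moreover have "{(a, b) \<in> insert (Suc n) ?N \<times> ?M. a > b} =
      {(a, b) \<in> ?N \<times> ?M. a > b} \<union> {Suc n} \<times> ?M" by auto
  moreover have "card ({(a, b) \<in> ?N \<times> ?M. a > b} \<union> {Suc n} \<times> ?M) =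
      card {(a, b) \<in> ?N \<times> ?M. a > b} + card ?M"
  proof (subst card_Un_disjoint)
    have "finite ?N"
      using num_letters_arrangement(1)[OF v] finite_subset by blast
    then show "finite {(a, b) \<in> ?N \<times> ?M. a > b}"
      by (auto intro: finite_subset[of _ "?N \<times> ?M", OF _ finite_cartesian_product])
  qed (use num_letters_arrangement(1)[OF v] in auto)
  moreover have "card ?M = n - l"
    using num_letters_arrangement[OF v] by (simp add: card_Diff_subset finite_subset)
  ultimately show ?thesis by (simp add: missing_inv_def inv_sets_def)
qed

text \<open>Fibres the partial permutations over their words of numerical letters, so that sums can
  be taken fibrewise.\<close>

lemma partial_perms_eq_insertions:
  assumes "k \<le> n"
  shows "partial_perms n k = (\<Union>v\<in>arrangements n (n - k). insertions hole v k)"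
proof (intro equalityI subsetI)
  fix w assume w: "w \<in> partial_perms n k"
  then have ins: "w \<in> insertions hole (filter (\<lambda>x. x \<noteq> hole) w) k"
    by (simp add: insertions_def partial_perms_def)
  moreover have "filter (\<lambda>x. x \<noteq> hole) w \<in> arrangements n (n - k)"
    using w length_insertions[OF ins] by (auto simp: arrangements_def partial_perms_def)
  ultimately show "w \<in> (\<Union>v\<in>arrangements n (n - k). insertions hole v k)" by blast
next
  fix w assume "w \<in> (\<Union>v\<in>arrangements n (n - k). insertions hole v k)"
  then obtain v where v: "v \<in> arrangements n (n - k)" and w: "w \<in> insertions hole v k" by blast
  have "length w = n"
    using length_insertions[OF w] v assms by (simp add: arrangements_def)
  with v w set_insertions[OF w] show "w \<in> partial_perms n k"
    by (auto simp: arrangements_def partial_perms_def insertions_def)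
qed

section \<open>Generating functions of hole-free words and of partial permutations\<close>

context nonzero_q_ints
begin

text \<open>For \<open>l = n\<close> the final position of the new letter earns
  \<open>\<beta>\<close>, which gives a \<open>beta_q_int\<close>; for \<open>l < n\<close> the new
  letter is never a right-to-left minimum and a plain \<open>q_int\<close> remains.\<close>

lemma sum_arrangements_Suc:
  assumes st: "mahonian st" and l: "l \<le> n"
  shows "(\<Sum>v\<in>arrangements (Suc n) (Suc l). \<beta> ^ rlmin v * q ^ (st v + missing_inv (Suc n) v)) =
    (\<Sum>v\<in>arrangements n (Suc l). \<beta> ^ rlmin v * q ^ (st v + missing_inv n v)) +
    (\<Sum>v\<in>arrangements n l. \<beta> ^ rlmin v * q ^ (st v + missing_inv n v)) *
      (q ^ (n - l) * (if l = n then beta_q_int \<beta> q (Suc n) else q_int q (Suc l)))"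
    (is "?L = ?A + ?B * ?f")
proof -
  let ?c = "enat (Suc n)"
  let ?W = "\<lambda>n v. \<beta> ^ rlmin v * q ^ (st v + missing_inv n v)"
  define b where "b = (if l = n then \<beta> else 1)"
  \<comment> \<open>A letter \<open>enat (Suc n)\<close> at the end is a right-to-left minimum only if no smaller letter is
    missing.\<close>
  have fiber: "(\<Sum>w\<in>insertions ?c v (Suc 0). ?W (Suc n) w) = ?W n v * ?f"
    if v: "v \<in> arrangements n l" for v
  proof -
    have "(\<Sum>w\<in>insertions ?c v (Suc 0). ?W (Suc n) w) =
        \<beta> ^ rlmin v * q ^ (missing_inv n v + (n - l)) *
        (\<Sum>w\<in>insertions ?c v (Suc 0). (if last w = ?c then b else 1) * q ^ st w)"
      unfolding sum_distrib_left
      by (intro sum.cong refl)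
        (auto simp: rlmin_insert_greatest[OF v] missing_inv_insert_greatest[OF v] b_def
          power_add algebra_simps)
    also have "(\<Sum>w\<in>insertions ?c v (Suc 0). (if last w = ?c then b else 1) * q ^ st w) =
        q ^ st v * beta_q_int b q (Suc l)"
      using sum_insert_greatest[OF st arrangements_less[OF v]] v by (simp add: arrangements_def)
    \<comment> \<open>For \<open>b = 1\<close>, \<open>beta_q_int b q\<close> is
      \<open>q_int q\<close>.\<close>
    finally show ?thesis
      by (auto simp: b_def beta_q_int_def power_add algebra_simps)
  qed
  have "?L = (\<Sum>v\<in>arrangements n (Suc l). ?W (Suc n) v) +
      (\<Sum>w\<in>(\<Union>v\<in>arrangements n l. insertions ?c v (Suc 0)). ?W (Suc n) w)"
    unfolding arrangements_Suc
  proof (rule sum.union_disjoint)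
    show "arrangements n (Suc l) \<inter> (\<Union>v\<in>arrangements n l. insertions ?c v (Suc 0)) = {}"
      using arrangements_less by (fastforce elim: insertions_1_split)
  qed (auto simp: finite_arrangements finite_insertions)
  also have "(\<Sum>v\<in>arrangements n (Suc l). ?W (Suc n) v) = ?A"
    by (intro sum.cong refl) (simp add: missing_inv_Suc)
  also have "(\<Sum>w\<in>(\<Union>v\<in>arrangements n l. insertions ?c v (Suc 0)). ?W (Suc n) w) =
      (\<Sum>v\<in>arrangements n l. \<Sum>w\<in>insertions ?c v (Suc 0). ?W (Suc n) w)"
    by (rule sum.UNION_disjoint) (auto simp: finite_arrangements finite_insertions insertions_disjoint)
  also have "\<dots> = ?B * ?f"
    unfolding sum_distrib_right by (intro sum.cong refl fiber)
  finally show ?thesis .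
qed

lemma sum_arrangements:
  assumes st: "mahonian st"
  shows "l \<le> n \<Longrightarrow> (\<Sum>v\<in>arrangements n l. \<beta> ^ rlmin v * q ^ (st v + missing_inv n v)) =
    (\<Prod>m = Suc (n - l)..n. beta_q_int \<beta> q m)"
proof (induction n arbitrary: l)
  case 0
  then show ?case
    using st by (simp add: arrangements_0 rlmin_Nil missing_inv_def num_letters_def inv_sets_def mahonian_def)
next
  case (Suc n)
  show ?case
  proof (cases l)
    case 0
    then show ?thesis
      using st by (simp add: arrangements_0 rlmin_Nil missing_inv_def num_letters_def inv_sets_def mahonian_def)
  next
    case (Suc l')
    with Suc.prems have l': "l' \<le> n" by simp
    show ?thesis
    proof (cases "l' = n")
      case True
      \<comment> \<open>For \<open>l' = n\<close> the sum over \<open>arrangements n (Suc n)\<close>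
        is empty and \<open>q ^ (n - l')\<close> is 1, so the recursion only appends one
        factor.\<close>
      have "(\<Prod>m = Suc 0..Suc n. beta_q_int \<beta> q m) =
          (\<Prod>m = Suc 0..n. beta_q_int \<beta> q m) * beta_q_int \<beta> q (Suc n)"
        by simp
      then show ?thesis
        using sum_arrangements_Suc[OF st l', of \<beta>] Suc.IH[OF l']
        unfolding Suc True by (simp add: arrangements_too_long)
    next
      case False
      then have less: "l' < n" using l' by simp
      define k where "k = n - Suc l'"
      have k: "n - l' = Suc k" "n = k + Suc l'" using less by (auto simp: k_def)
      \<comment> \<open>\<open>?P\<close> divides the products for \<open>(n, l')\<close>,
        \<open>(n, Suc l')\<close> and \<open>(Suc n, Suc l')\<close>. Once it is factored out, the
        recursion is the identity \<open>3\<close>.\<close>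
      let ?P = "\<Prod>m = Suc (Suc k)..n. beta_q_int \<beta> q m"
      have 1: "(\<Prod>m = Suc k..n. beta_q_int \<beta> q m) = beta_q_int \<beta> q (Suc k) * ?P"
        by (rule prod.atLeast_Suc_atMost) (use k in simp)
      have 2: "(\<Prod>m = Suc (Suc k)..Suc n. beta_q_int \<beta> q m) = ?P * beta_q_int \<beta> q (Suc n)"
        using k by simp
      have 3: "beta_q_int \<beta> q (Suc n) = beta_q_int \<beta> q (Suc k) + q ^ Suc k * q_int q (Suc l')"
        using q_int_add[of q "Suc l'" "Suc k"] k by (simp add: beta_q_int_def add.commute)
      have 4: "Suc n - Suc l' = Suc k" using k by simp
      show ?thesis
        using sum_arrangements_Suc[OF st l', of \<beta>] Suc.IH[OF l'] Suc.IH[of "Suc l'"] False less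
        unfolding Suc 4 k(1) k_def[symmetric] 1 2 3 by (simp add: algebra_simps)
    qed
  qed
qed

lemma sum_partial_perms:
  assumes st: "mahonian st" and k: "k \<le> n"
  shows "(\<Sum>w\<in>partial_perms n k.
      \<beta> ^ rlmin w * q ^ (st w + inv_sets (num_letters w) (missing_letters w))) =
    q_binomial q n k * (\<Prod>m = k + 1..n. beta_q_int \<beta> q m)"
proof -
  let ?W = "\<lambda>w. \<beta> ^ rlmin w * q ^ (st w + inv_sets (num_letters w) (missing_letters w))"
  have fiber: "(\<Sum>w\<in>insertions hole v k. ?W w) =
      q_binomial q n k * (\<beta> ^ rlmin v * q ^ (st v + missing_inv n v))"
    if v: "v \<in> arrangements n (n - k)" for v
  proof -
    have len: "length v + k = n" using v k by (simp add: arrangements_def)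
    have "?W w = \<beta> ^ rlmin v * q ^ missing_inv n v * q ^ st w" if w: "w \<in> insertions hole v k" for w
    proof -
      have "v = filter (\<lambda>x. x \<noteq> hole) w" using w by (simp add: insertions_def)
      then have "rlmin w = rlmin v" "num_letters w = num_letters v"
        using rlmin_filter_hole[of w] by (auto simp: num_letters_def)
      moreover have "length w = n" using length_insertions[OF w] len by simp
      ultimately show ?thesis
        by (simp add: missing_letters_def missing_inv_def power_add)
    qed
    then have "(\<Sum>w\<in>insertions hole v k. ?W w) =
        \<beta> ^ rlmin v * q ^ missing_inv n v * (\<Sum>w\<in>insertions hole v k. q ^ st w)"
      unfolding sum_distrib_left by (intro sum.cong refl)
    also have "(\<Sum>w\<in>insertions hole v k. q ^ st w) = q ^ st v * q_binomial q n k"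
      using st arrangements_less_hole[OF v] len by (simp add: mahonian_def)
    finally show ?thesis by (simp add: power_add)
  qed
  have "(\<Sum>w\<in>partial_perms n k. ?W w) =
      (\<Sum>v\<in>arrangements n (n - k). \<Sum>w\<in>insertions hole v k. ?W w)"
    unfolding partial_perms_eq_insertions[OF k]
    by (rule sum.UNION_disjoint) (auto simp: finite_arrangements finite_insertions insertions_disjoint)
  also have "\<dots> = q_binomial q n k *
      (\<Sum>v\<in>arrangements n (n - k). \<beta> ^ rlmin v * q ^ (st v + missing_inv n v))"
    unfolding sum_distrib_left by (intro sum.cong refl fiber)
  \<comment> \<open>With \<open>l = n - k\<close> the lower bound \<open>Suc (n - l)\<close> of the
    product is \<open>k + 1\<close>, as \<open>k \<le> n\<close>.\<close>
  also have "\<dots> = q_binomial q n k * (\<Prod>m = k + 1..n. beta_q_int \<beta> q m)"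
    using sum_arrangements[OF st, of "n - k" n \<beta>] k by simp
  finally show ?thesis .
qed

end

section \<open>Nonvanishing of the q-integers at the indeterminate\<close>

lemma q_int_q_var_nonzero: "q_int q_var (Suc m) \<noteq> 0"
proof -
  \<comment> \<open>It suffices to track the constant coefficient: passing from \<open>p\<close> to
    \<open>1 + q * p\<close> leaves it equal to 1, so the polynomial is never zero.\<close>
  have "\<exists>p. q_int q_var (Suc m) = Fract [:p:] 1 \<and> coeff p 0 = 1"
  proof (induction m)
    case 0
    show ?case by (intro exI[of _ 1]) (simp add: q_int_1 One_fract_def one_pCons)
  next
    case (Suc m)
    then obtain p where p: "q_int q_var (Suc m) = Fract [:p:] 1" "coeff p 0 = 1" by blast
    have "q_int q_var (Suc (Suc m)) = 1 + q_var * q_int q_var (Suc m)"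
      using q_int_add[of q_var "Suc m" "Suc 0"] by (simp add: q_int_1)
    also have "\<dots> = Fract [:1 + [:0, 1:] * p:] 1"
      unfolding p(1) by (simp add: q_var_def One_fract_def one_pCons)
    finally show ?case by (intro exI[of _ "1 + [:0, 1:] * p"]) simp
  qed
  then obtain p where "q_int q_var (Suc m) = Fract [:p:] 1" "coeff p 0 = 1" by blast
  then show ?thesis by (auto simp: Zero_fract_def eq_fract)
qed

theorem theorem2p1:
  fixes n k :: nat
  assumes "k \<le> n"
  shows "(\<Sum>w\<in>partial_perms n k. beta_var ^ rlmin w * q_var ^ maj_stat w)
           = (\<Sum>w\<in>partial_perms n k. beta_var ^ rlmin w * q_var ^ inv_stat w)
       \<and> (\<Sum>w\<in>partial_perms n k. beta_var ^ rlmin w * q_var ^ inv_stat w)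
           = q_binomial q_var n k * (\<Prod>m = k + 1..n. beta_q_int beta_var q_var m)"
proof -
  interpret nonzero_q_ints q_var
    by unfold_locales (rule q_int_q_var_nonzero)
  show ?thesis
    unfolding maj_stat_def inv_stat_def
    using sum_partial_perms[OF mahonian_inv0 assms] sum_partial_perms[OF mahonian_maj0 assms]
    by simp
qed

end
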